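(* Let $G$ be a finite simple graph with $es_{\chi'}(G)=2$. Then there exists a mitigating set of $G$ which is a $2$-matching.
   Context: All graphs are finite, simple and have at least one edge. $\chi'(G)$ is the chromatic index of $G$. A mitigating set of $G$ is a set of edges $F\subseteq E(G)$ such that $\chi'(G\setminus F)<\chi'(G)$, where $G\setminus F$ is $G$ with the edges of $F$ deleted (all vertices are kept; an edgeless graph has chromatic index $0$). The chromatic edge stability index $es_{\chi'}(G)$ is the minimum cardinality of a mitigating set of $G$. A matching is a set of pairwise non-adjacent edges; a $k$-matching is a matching of size $k$. *)

theory Defs
  imports Main
begin

record 'a graph =
  verts :: "'a set"
  edges :: "'a set set"

definition finite_simple_graph :: "'a graph \<Rightarrow> bool" where
  "finite_simple_graph G \<longleftrightarrow>
     finite (verts G) \<and> (\<forall>e\<in>edges G. e \<subseteq> verts G \<and> card e = 2)"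

definition delete_edges :: "'a graph \<Rightarrow> 'a set set \<Rightarrow> 'a graph" where
  "delete_edges G F = G\<lparr>edges := edges G - F\<rparr>"

definition adjacent_edges :: "'a set \<Rightarrow> 'a set \<Rightarrow> bool" where
  "adjacent_edges e f \<longleftrightarrow> e \<noteq> f \<and> e \<inter> f \<noteq> {}"

definition proper_edge_coloring :: "'a graph \<Rightarrow> nat \<Rightarrow> ('a set \<Rightarrow> nat) \<Rightarrow> bool" where
  "proper_edge_coloring G k c \<longleftrightarrow>
     (\<forall>e\<in>edges G. c e < k) \<and>
     (\<forall>e\<in>edges G. \<forall>f\<in>edges G. adjacent_edges e f \<longrightarrow> c e \<noteq> c f)"

definition chromatic_index :: "'a graph \<Rightarrow> nat" where
  "chromatic_index G = (LEAST k. \<exists>c. proper_edge_coloring G k c)"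

definition mitigating_set :: "'a graph \<Rightarrow> 'a set set \<Rightarrow> bool" where
  "mitigating_set G F \<longleftrightarrow>
     F \<subseteq> edges G \<and> chromatic_index (delete_edges G F) < chromatic_index G"

text \<open>The minimum is attained only if \<open>G\<close> has a mitigating set; for finite graphs
  this means having at least one edge (see \<open>mitigating_set_all_edges\<close> below).\<close>

definition chromatic_edge_stability_index :: "'a graph \<Rightarrow> nat" where
  "chromatic_edge_stability_index G = (LEAST n. \<exists>F. mitigating_set G F \<and> card F = n)"

definition matching :: "'a graph \<Rightarrow> 'a set set \<Rightarrow> bool" where
  "matching G M \<longleftrightarrow> M \<subseteq> edges G \<and> (\<forall>e\<in>M. \<forall>f\<in>M. \<not> adjacent_edges e f)"

definition k_matching :: "nat \<Rightarrow> 'a graph \<Rightarrow> 'a set set \<Rightarrow> bool" where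
  "k_matching k G M \<longleftrightarrow> matching G M \<and> finite M \<and> card M = k"

lemma finite_edges:
  assumes "finite_simple_graph G"
  shows "finite (edges G)"
proof -
  have "edges G \<subseteq> Pow (verts G)"
    using assms by (auto simp: finite_simple_graph_def)
  then show ?thesis
    using assms by (meson finite_Pow_iff finite_subset finite_simple_graph_def)
qed

lemma proper_edge_coloring_exists:
  assumes "finite_simple_graph G"
  shows "\<exists>k c. proper_edge_coloring G k c"
proof -
  obtain c :: "'a set \<Rightarrow> nat" and n where c: "c ` edges G = {i. i < n}" "inj_on c (edges G)"
    using finite_imp_inj_to_nat_seg[OF finite_edges[OF assms]] by blast
  have "proper_edge_coloring G n c"
    unfolding proper_edge_coloring_def adjacent_edges_def
    using c by (auto dest: inj_onD)
  then show ?thesis by blast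
qed

lemma chromatic_index_edgeless:
  assumes "edges G = {}"
  shows "chromatic_index G = 0"
  unfolding chromatic_index_def proper_edge_coloring_def using assms by simp

lemma mitigating_set_all_edges:
  assumes "finite_simple_graph G" "edges G \<noteq> {}"
  shows "mitigating_set G (edges G)"
proof -
  obtain c where c: "proper_edge_coloring G (chromatic_index G) c"
    unfolding chromatic_index_def
    using LeastI_ex[OF proper_edge_coloring_exists[OF assms(1)]] by blast
  have "chromatic_index G > 0"
    using c assms(2) by (auto simp: proper_edge_coloring_def)
  moreover have "chromatic_index (delete_edges G (edges G)) = 0"
    by (rule chromatic_index_edgeless) (simp add: delete_edges_def)
  ultimately show ?thesis by (simp add: mitigating_set_def)
qed

end

theory Submission
  imports Defs "HOL-Combinatorics.Transposition"
begin

text \<open>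
  Write \<open>n + 1\<close> for the chromatic index of \<open>G\<close>, and suppose that deleting two edges
  \<open>xy\<close> and \<open>xz\<close> with a common end leaves a graph with a proper \<open>n\<close>-coloring; two disjoint
  edges would already be the required matching. No single edge is mitigating, so the two
  uncolored edges can be moved around, but neither can be absorbed into the coloring.

  At most \<open>n + 1\<close> edges meet \<open>x\<close>, two of them uncolored, hence some color \<open>\<alpha>\<close> is
  missing at \<open>x\<close>. It occurs at \<open>y\<close>, since otherwise \<open>xy\<close> could be colored \<open>\<alpha>\<close>. Let
  \<open>yw\<close> be the edge of color \<open>\<alpha>\<close> at \<open>y\<close>. Coloring \<open>xy\<close> with \<open>\<alpha>\<close> and uncoloring \<open>yw\<close>
  leaves \<open>yw\<close> and \<open>xz\<close> uncolored, and these are disjoint unless \<open>w = z\<close>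
  (lemma \<open>move_uncolored_edge\<close>).

  The remaining obstacle is a triangle \<open>xyz\<close> whose edge \<open>yz\<close> has color \<open>\<alpha>\<close>. Remove
  all three edges of the triangle: now \<open>x\<close>, \<open>y\<close>, \<open>z\<close> play symmetric roles, and \<open>\<alpha>\<close> is missing at
  each of them. Take any other color \<open>\<beta>\<close>; one exists because a triangle needs three colors.
  In the subgraph of edges colored \<open>\<alpha>\<close> or \<open>\<beta>\<close> the three vertices are ends of paths, possibly
  trivial ones, and a path has two ends. So the path at one of them, say \<open>u\<close>, avoids the other two,
  say \<open>v\<close> and \<open>w\<close>. Exchanging the two colors along it makes \<open>\<beta>\<close> missing at \<open>u\<close>, while \<open>vw\<close> can
  still be colored \<open>\<alpha>\<close> (lemma \<open>kempe_change_at_one_of_three\<close>). Then only \<open>uv\<close> and \<open>uw\<close>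
  are uncolored, and \<open>vw\<close> does not have the color \<open>\<beta>\<close> missing at \<open>u\<close>, so the first argument applies.
\<close>

section \<open>Colorings of sets of edges\<close>

definition proper_on :: "'a set set \<Rightarrow> nat \<Rightarrow> ('a set \<Rightarrow> nat) \<Rightarrow> bool" where
  "proper_on D n c \<longleftrightarrow>
     (\<forall>e\<in>D. c e < n) \<and> (\<forall>e\<in>D. \<forall>f\<in>D. e \<noteq> f \<and> e \<inter> f \<noteq> {} \<longrightarrow> c e \<noteq> c f)"

definition missing_at :: "'a set set \<Rightarrow> ('a set \<Rightarrow> nat) \<Rightarrow> 'a \<Rightarrow> nat \<Rightarrow> bool" where
  "missing_at D c x \<alpha> \<longleftrightarrow> (\<forall>e\<in>D. x \<in> e \<longrightarrow> c e \<noteq> \<alpha>)"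

lemma proper_on_subset: "proper_on D n c \<Longrightarrow> D' \<subseteq> D \<Longrightarrow> proper_on D' n c"
  unfolding proper_on_def by blast

lemma missing_at_subset: "missing_at D c x \<alpha> \<Longrightarrow> D' \<subseteq> D \<Longrightarrow> missing_at D' c x \<alpha>"
  unfolding missing_at_def by blast

lemma proper_on_eqI:
  "proper_on D n c \<Longrightarrow> e \<in> D \<Longrightarrow> f \<in> D \<Longrightarrow> v \<in> e \<Longrightarrow> v \<in> f \<Longrightarrow> c e = c f \<Longrightarrow> e = f"
  unfolding proper_on_def by blast

lemma proper_on_insert:
  assumes "proper_on D n c" "\<alpha> < n" "missing_at D c x \<alpha>" "missing_at D c y \<alpha>"
  shows "proper_on (insert {x, y} D) n (c({x, y} := \<alpha>))"
  using assms unfolding proper_on_def missing_at_def by auto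

lemma proper_edge_coloring_delete_edges:
  "proper_edge_coloring (delete_edges G F) n c \<longleftrightarrow> proper_on (edges G - F) n c"
  by (auto simp: proper_edge_coloring_def delete_edges_def proper_on_def adjacent_edges_def)

lemma proper_edge_coloring_iff: "proper_edge_coloring G n c \<longleftrightarrow> proper_on (edges G) n c"
  by (auto simp: proper_edge_coloring_def proper_on_def adjacent_edges_def)

lemma mitigating_set_iff:
  assumes "finite_simple_graph G" "chromatic_index G = Suc n"
  shows "mitigating_set G F \<longleftrightarrow> F \<subseteq> edges G \<and> (\<exists>c. proper_on (edges G - F) n c)"
proof -
  let ?H = "delete_edges G F"
  have H: "finite_simple_graph ?H"
    using assms(1) by (auto simp: finite_simple_graph_def delete_edges_def)
  have "chromatic_index ?H < Suc n \<longleftrightarrow> (\<exists>c. proper_edge_coloring ?H n c)"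
  proof
    assume *: "chromatic_index ?H < Suc n"
    obtain c where "proper_edge_coloring ?H (chromatic_index ?H) c"
      unfolding chromatic_index_def
      using LeastI_ex[OF proper_edge_coloring_exists[OF H]] by blast
    with * have "proper_edge_coloring ?H n c"
      unfolding proper_edge_coloring_def by fastforce
    then show "\<exists>c. proper_edge_coloring ?H n c" by blast
  next
    assume "\<exists>c. proper_edge_coloring ?H n c"
    then have "chromatic_index ?H \<le> n"
      unfolding chromatic_index_def by (rule Least_le)
    then show "chromatic_index ?H < Suc n" by simp
  qed
  then show ?thesis
    using assms(2) by (simp add: mitigating_set_def proper_edge_coloring_delete_edges)
qed

text \<open>
  The coloring \<open>c0\<close> serves only to bound the degree of \<open>x\<close> by \<open>n + 1\<close>.
\<close>

lemma missing_color_exists: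
  assumes "finite E" "proper_on E (Suc n) c0" "proper_on (E - {e, f}) n c"
    and "e \<in> E" "f \<in> E" "e \<noteq> f" "x \<in> e" "x \<in> f"
  obtains \<alpha> where "\<alpha> < n" "missing_at (E - {e, f}) c x \<alpha>"
proof -
  define A where "A = {d \<in> E. x \<in> d}"
  define B where "B = {d \<in> E - {e, f}. x \<in> d}"
  have A: "A = insert e (insert f B)" "e \<notin> B" "f \<notin> B" and B: "finite B"
    using assms by (auto simp: A_def B_def)
  have "inj_on c0 A"
    unfolding A_def by (rule inj_onI) (use proper_on_eqI[OF assms(2)] in blast)
  moreover have "c0 ` A \<subseteq> {..<Suc n}"
    using assms(2) by (auto simp: proper_on_def A_def)
  ultimately have "card A \<le> card {..<Suc n}"
    by (rule card_inj_on_le) (rule finite_lessThan)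
  moreover have "card A = Suc (Suc (card B))"
    using A B \<open>e \<noteq> f\<close> by simp
  ultimately have "card B < n" by simp
  then have "card (c ` B) < n"
    using card_image_le[OF B, of c] by (rule le_less_trans[rotated])
  have "\<not> {..<n} \<subseteq> c ` B"
  proof
    assume "{..<n} \<subseteq> c ` B"
    then have "card {..<n} \<le> card (c ` B)"
      by (rule card_mono[OF finite_imageI[OF B]])
    with \<open>card (c ` B) < n\<close> show False by simp
  qed
  then obtain \<alpha> where \<alpha>: "\<alpha> < n" "\<alpha> \<notin> c ` B" by blast
  have "missing_at (E - {e, f}) c x \<alpha>"
    unfolding missing_at_def using \<alpha>(2) by (auto simp: B_def)
  with \<alpha>(1) show thesis by (rule that)
qed

section \<open>Moving an uncolored edge\<close>

text \<open>
  The edge \<open>yw\<close> that loses its color is the edge of color \<open>\<beta>\<close> at \<open>y\<close>: such an edge exists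
  because \<open>xy\<close> cannot be given the color \<open>\<beta>\<close> outright, it avoids \<open>x\<close> because \<open>\<beta>\<close> is
  missing there, and it avoids \<open>z\<close> by the hypothesis on \<open>yz\<close>.
\<close>

lemma move_uncolored_edge:
  assumes edges2: "\<forall>e\<in>E. card e = 2"
    and dist: "x \<noteq> y" "x \<noteq> z" "y \<noteq> z"
    and xy: "{x, y} \<in> E"
    and c: "proper_on (E - {{x, y}, {x, z}}) n c"
    and critical: "\<not> (\<exists>c'. proper_on (E - {{x, z}}) n c')"
    and \<beta>: "\<beta> < n" "missing_at (E - {{x, y}, {x, z}}) c x \<beta>"
    and yz: "{y, z} \<in> E \<longrightarrow> c {y, z} \<noteq> \<beta>"
  obtains w c' where "{y, w} \<in> E" "w \<noteq> x" "w \<noteq> y" "w \<noteq> z"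
    "proper_on (E - {{y, w}, {x, z}}) n c'"
proof -
  let ?D = "E - {{x, y}, {x, z}}"
  have "\<not> missing_at ?D c y \<beta>"
  proof
    assume "missing_at ?D c y \<beta>"
    from proper_on_insert[OF c \<beta> this] have "proper_on (insert {x, y} ?D) n (c({x, y} := \<beta>))" .
    then have "proper_on (E - {{x, z}}) n (c({x, y} := \<beta>))"
      by (rule proper_on_subset) auto
    with critical show False by blast
  qed
  then obtain e where e: "e \<in> ?D" "y \<in> e" "c e = \<beta>"
    by (auto simp: missing_at_def)
  have "card e = 2" using e edges2 by auto
  then obtain w where w: "e = {y, w}" "w \<noteq> y"
    using e(2) by (auto simp: card_2_iff)
  have "w \<noteq> x" using e w \<beta>(2) by (auto simp: missing_at_def)
  moreover have "w \<noteq> z" using e w yz by auto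
  moreover have "proper_on (insert {x, y} (?D - {e})) n (c({x, y} := \<beta>))"
  proof (rule proper_on_insert)
    show "proper_on (?D - {e}) n c" using c by (rule proper_on_subset) auto
    show "missing_at (?D - {e}) c x \<beta>" using \<beta>(2) by (rule missing_at_subset) auto
    show "missing_at (?D - {e}) c y \<beta>"
      unfolding missing_at_def
    proof (intro ballI impI notI)
      fix d assume d: "d \<in> ?D - {e}" "y \<in> d" "c d = \<beta>"
      then have "d = e" using e by (intro proper_on_eqI[OF c, of d e y]) auto
      with d(1) show False by blast
    qed
  qed (fact \<beta>(1))
  then have "proper_on (E - {{y, w}, {x, z}}) n (c({x, y} := \<beta>))"
    by (rule proper_on_subset) (use w in auto)
  moreover have "{y, w} \<in> E" using e(1) w(1) by blast
  ultimately show thesis using w(2) by (intro that)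
qed

section \<open>Orbits of two involutions\<close>

text \<open>
  This is the statement that a path has at most two ends, in a form that needs no paths. If \<open>a\<close> and
  \<open>b\<close> exchange the ends of the edges of two colors, then the component of a fixed point \<open>u\<close> of
  \<open>a\<close> is the orbit of \<open>u\<close> under \<open>r = b \<circ> a\<close>, because \<open>a\<close> conjugates \<open>r\<close> to its inverse. For
  the same reason, if \<open>r\<^sup>i u\<close> is again fixed by \<open>a\<close>, then \<open>r\<^sup>2\<^sup>i u = u\<close>. In an orbit of length
  \<open>L\<close> this leaves only \<open>i = 0\<close> and \<open>i = L / 2\<close>, so an orbit contains at most two fixed points of
  \<open>a\<close>, and of three fixed points at least one lies in an orbit without the others.
\<close>

lemma isolated_fixed_point:
  fixes a b :: "'v \<Rightarrow> 'v"
  defines "r \<equiv> b \<circ> a"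
  assumes a: "\<And>v. a (a v) = v" and b: "\<And>v. b (b v) = v"
    and fin: "\<And>u. finite (range (\<lambda>n. (r ^^ n) u))"
    and fixed: "a x = x" "a y = y" "a z = z"
    and dist: "x \<noteq> y" "x \<noteq> z" "y \<noteq> z"
  obtains S u where "S \<inter> {x, y, z} = {u}" "\<And>v. v \<in> S \<Longrightarrow> a v \<in> S"
    "\<And>v. v \<in> S \<Longrightarrow> b v \<in> S"
proof -
  define S where "S u = range (\<lambda>n. (r ^^ n) u)" for u
  have "inj r"
    unfolding r_def by (rule injI) (metis a b comp_apply)
  \<comment> \<open>Conjugation by \<open>a\<close> inverts \<open>r\<close>.\<close>
  have reverse: "(r ^^ n) (a ((r ^^ n) v)) = a v" for n v
  proof (induction n arbitrary: v)
    case (Suc n)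
    have "(r ^^ Suc n) (a ((r ^^ Suc n) v)) = r ((r ^^ n) (a ((r ^^ n) (r v))))"
      by (simp add: funpow_swap1)
    also have "\<dots> = r (a (r v))" by (simp only: Suc.IH)
    also have "\<dots> = a v" by (simp add: r_def a b)
    finally show ?case .
  qed simp
  have inj_pow: "(r ^^ n) v = (r ^^ n) w \<Longrightarrow> v = w" for n v w
    using inj_fn[OF \<open>inj r\<close>, of n] by (auto dest: injD)
  have period: "\<exists>p>0. (r ^^ p) u = u" for u
  proof -
    have "finite {y. \<exists>n. y = (r ^^ n) u}"
      using fin[of u] by (simp add: full_SetCompr_eq)
    from funpow_inj_finite[OF \<open>inj r\<close> this] show ?thesis by blast
  qed
  have inverse: "\<exists>m. (r ^^ n) ((r ^^ m) u) = u" for n u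
  proof -
    obtain p where p: "p > 0" "(r ^^ p) u = u" using period by blast
    \<comment> \<open>A multiple of the period that is at least \<open>n\<close>.\<close>
    then have "n + (p * n - n) = p * n" by simp
    moreover have "(r ^^ (p * n)) u = u"
      using funpow_mod_eq[OF p(2), of "p * n"] by simp
    ultimately have "(r ^^ n) ((r ^^ (p * n - n)) u) = u"
      by (metis comp_apply funpow_add)
    then show ?thesis ..
  qed
  have a_closed: "a v \<in> S u" if "a u = u" "v \<in> S u" for u v
  proof -
    obtain n where n: "v = (r ^^ n) u" using \<open>v \<in> S u\<close> by (auto simp: S_def)
    obtain m where "(r ^^ n) ((r ^^ m) u) = u" using inverse by blast
    then have "(r ^^ n) (a v) = (r ^^ n) ((r ^^ m) u)"
      using reverse[of n u] n \<open>a u = u\<close> by simp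
    then have "a v = (r ^^ m) u" by (rule inj_pow)
    then show ?thesis by (simp add: S_def)
  qed
  have r_closed: "r v \<in> S u" if "v \<in> S u" for u v
  proof -
    from that obtain n where "v = (r ^^ n) u" by (auto simp: S_def)
    then have "r v = (r ^^ Suc n) u" by simp
    then show ?thesis unfolding S_def by (rule range_eqI)
  qed
  have b_closed: "b v \<in> S u" if "a u = u" "v \<in> S u" for u v
    using r_closed[OF a_closed[OF that]] by (simp add: r_def a)
  have sym: "v \<in> S u" if "u \<in> S v" for u v
  proof -
    from that obtain n where n: "u = (r ^^ n) v" by (auto simp: S_def)
    obtain m where m: "(r ^^ n) ((r ^^ m) u) = u" using inverse by blast
    then have "(r ^^ m) u = v" using n inj_pow[of n] by simp
    then show ?thesis unfolding S_def by (metis rangeI)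
  qed
  have refl: "u \<in> S u" for u
    unfolding S_def by (rule range_eqI[of _ _ 0]) simp
  have not_both: "y \<notin> S x \<or> z \<notin> S x"
  proof (rule ccontr)
    define L where "L = (LEAST p. p > 0 \<and> (r ^^ p) x = x)"
    have L: "L > 0" "(r ^^ L) x = x"
      using LeastI_ex[OF period[of x]] by (auto simp: L_def)
    have half: "\<exists>i<L. v = (r ^^ i) x \<and> 2 * i = L"
      if "v \<in> S x" "v \<noteq> x" "a v = v" for v
    proof -
      obtain j where "v = (r ^^ j) x" using \<open>v \<in> S x\<close> by (auto simp: S_def)
      then obtain i where i: "v = (r ^^ i) x" "i < L"
        using funpow_mod_eq[OF L(2), of j] L(1) by (metis mod_less_divisor)
      have "(r ^^ (2 * i)) x = x"
        using reverse[of i x] i(1) \<open>a v = v\<close> fixed(1) by (simp add: mult_2 funpow_add)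
      then have "(r ^^ ((2 * i) mod L)) x = x"
        using funpow_mod_eq[OF L(2), of "2 * i"] by simp
      then have "(2 * i) mod L = 0"
        using not_less_Least[of "(2 * i) mod L" "\<lambda>p. p > 0 \<and> (r ^^ p) x = x"] L(1)
        unfolding L_def[symmetric] by auto
      then obtain q where q: "2 * i = L * q"
        by (meson dvdE mod_eq_0_iff_dvd)
      have "L * q < L * 2" using i(2) unfolding q[symmetric] by simp
      then have "q < 2" by simp
      moreover have "i \<noteq> 0" using i(1) \<open>v \<noteq> x\<close> by (auto intro: gr0I)
      then have "q \<noteq> 0" using q by (intro notI) simp
      ultimately have "q = 1" by simp
      with q have "2 * i = L" by simp
      with i show ?thesis by blast
    qed
    assume "\<not> (y \<notin> S x \<or> z \<notin> S x)"
    then obtain i j where "y = (r ^^ i) x" "2 * i = L" "z = (r ^^ j) x" "2 * j = L"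
      using half[of y] half[of z] fixed dist by metis
    then have "y = z" by (metis mult_cancel1 zero_neq_numeral)
    with dist show False by blast
  qed
  consider "y \<notin> S x" "z \<notin> S x" | "x \<notin> S y" "z \<notin> S y" | "x \<notin> S z" "y \<notin> S z"
  proof -
    have S_trans: "q \<in> S u" if "p \<in> S u" "q \<in> S p" for p u q
    proof -
      from that obtain n m where "p = (r ^^ n) u" "q = (r ^^ m) p"
        by (auto simp: S_def)
      then have "q = (r ^^ (m + n)) u" by (simp add: funpow_add)
      then show ?thesis unfolding S_def by (rule range_eqI)
    qed
    show thesis
      using not_both S_trans[of y x z] S_trans[of z x y] sym that by blast
  qed
  then show thesis
  proof cases
    case 1
    then show thesis
      using that[of "S x" x] refl a_closed b_closed fixed by blast
  next
    case 2
    then show thesis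
      using that[of "S y" y] refl a_closed b_closed fixed by blast
  next
    case 3
    then show thesis
      using that[of "S z" z] refl a_closed b_closed fixed by blast
  qed
qed

section \<open>Kempe changes\<close>

text \<open>
  The value at a vertex without an edge of color \<open>\<alpha>\<close> is the vertex itself. This makes
  the map an involution for a proper coloring, with every vertex that misses \<open>\<alpha>\<close> a fixed point.
\<close>

definition partner :: "'a set set \<Rightarrow> ('a set \<Rightarrow> nat) \<Rightarrow> nat \<Rightarrow> 'a \<Rightarrow> 'a" where
  "partner D c \<alpha> v =
     (if \<exists>w. {v, w} \<in> D \<and> c {v, w} = \<alpha> then SOME w. {v, w} \<in> D \<and> c {v, w} = \<alpha> else v)"

lemma partner_eq:
  assumes "proper_on D n c" "{v, w} \<in> D"
  shows "partner D c (c {v, w}) v = w"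
proof -
  have "w' = w" if "{v, w'} \<in> D" "c {v, w'} = c {v, w}" for w'
    using proper_on_eqI[OF assms(1) that(1) assms(2), of v] that(2)
    by (auto simp: doubleton_eq_iff)
  then have "(SOME w'. {v, w'} \<in> D \<and> c {v, w'} = c {v, w}) = w"
    using assms(2) by (intro some_equality) auto
  then show ?thesis using assms(2) by (auto simp: partner_def)
qed

lemma partner_missing: "missing_at D c v \<alpha> \<Longrightarrow> partner D c \<alpha> v = v"
  by (auto simp: missing_at_def partner_def)

lemma partner_cases:
  assumes "proper_on D n c"
  obtains "partner D c \<alpha> v = v" | w where "{v, w} \<in> D" "c {v, w} = \<alpha>" "partner D c \<alpha> v = w"
proof (cases "\<exists>w. {v, w} \<in> D \<and> c {v, w} = \<alpha>")
  case True
  then show thesis using partner_eq[OF assms] that(2) by blast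
next
  case False
  then have "partner D c \<alpha> v = v" by (simp only: partner_def if_False)
  then show thesis by (rule that(1))
qed

lemma partner_involution:
  assumes "proper_on D n c"
  shows "partner D c \<alpha> (partner D c \<alpha> v) = v"
proof (rule partner_cases[OF assms, of \<alpha> v])
  fix w assume "{v, w} \<in> D" "c {v, w} = \<alpha>" "partner D c \<alpha> v = w"
  then show ?thesis using partner_eq[OF assms, of w v] by (simp add: insert_commute)
qed simp

text \<open>
  A set closed under both partner maps is a union of components of the subgraph of edges
  colored \<open>\<alpha>\<close> or \<open>\<beta>\<close>, so an edge with only one end in it has neither color, and exchanging
  the two colors does not affect that edge. Around each single vertex the colors are
  therefore either all permuted or all kept.
\<close>

lemma kempe_change:
  assumes c: "proper_on D n c"
    and edges2: "\<forall>e\<in>D. card e = 2"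
    and colors: "\<alpha> < n" "\<beta> < n"
    and closed: "\<And>v. v \<in> S \<Longrightarrow> partner D c \<alpha> v \<in> S" "\<And>v. v \<in> S \<Longrightarrow> partner D c \<beta> v \<in> S"
  obtains c' where "proper_on D n c'"
    "\<And>v. v \<in> S \<Longrightarrow> missing_at D c v \<alpha> \<Longrightarrow> missing_at D c' v \<beta>"
    "\<And>v. v \<notin> S \<Longrightarrow> missing_at D c v \<alpha> \<Longrightarrow> missing_at D c' v \<alpha>"
proof -
  define t where "t = Transposition.transpose \<alpha> \<beta>"
  define c' where "c' e = (if e \<inter> S = {} then c e else t (c e))" for e
  have t_inj: "t i = t j \<longleftrightarrow> i = j" for i j
    unfolding t_def by (rule inj_eq[OF inj_transpose])
  have local: "c' e = (if v \<in> S then t (c e) else c e)" if "e \<in> D" "v \<in> e" for e v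
  proof -
    have "card e = 2" using edges2 \<open>e \<in> D\<close> by blast
    then obtain w where w: "e = {v, w}" using \<open>v \<in> e\<close> by (auto simp: card_2_iff)
    have "t (c e) = c e" if "v \<notin> S" "w \<in> S"
    proof -
      have "partner D c (c e) w = v"
        using partner_eq[OF c, of w v] w \<open>e \<in> D\<close> by (simp add: insert_commute)
      then have "c e \<noteq> \<alpha>" "c e \<noteq> \<beta>" using closed[of w] that by auto
      then show ?thesis by (simp add: t_def)
    qed
    then show ?thesis using w by (auto simp: c'_def)
  qed
  have "proper_on D n c'"
    unfolding proper_on_def
  proof (intro conjI ballI impI)
    fix e assume "e \<in> D"
    then have "c e < n" using c by (simp add: proper_on_def)
    then show "c' e < n"
      using colors by (auto simp: c'_def t_def Transposition.transpose_def)
  next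
    fix e f assume ef: "e \<in> D" "f \<in> D" "e \<noteq> f \<and> e \<inter> f \<noteq> {}"
    then obtain v where v: "v \<in> e" "v \<in> f" by blast
    have "c e \<noteq> c f" using c ef by (simp add: proper_on_def)
    then show "c' e \<noteq> c' f"
      using local[OF ef(1) v(1)] local[OF ef(2) v(2)] t_inj by simp
  qed
  moreover have "missing_at D c' v \<beta>" if "v \<in> S" "missing_at D c v \<alpha>" for v
    using that local t_inj[of _ \<alpha>] by (auto simp: missing_at_def t_def)
  moreover have "missing_at D c' v \<alpha>" if "v \<notin> S" "missing_at D c v \<alpha>" for v
    using that local by (auto simp: missing_at_def)
  ultimately show thesis using that by blast
qed

text \<open>
  The component on which the colors are exchanged is an orbit of the two partner maps that contains
  exactly one of the three vertices.
\<close>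

lemma kempe_change_at_one_of_three:
  assumes c: "proper_on D n c"
    and D: "finite D" "\<forall>e\<in>D. card e = 2"
    and colors: "\<alpha> < n" "\<beta> < n"
    and missing: "missing_at D c x \<alpha>" "missing_at D c y \<alpha>" "missing_at D c z \<alpha>"
    and dist: "x \<noteq> y" "x \<noteq> z" "y \<noteq> z"
  obtains u c' where "u \<in> {x, y, z}" "proper_on D n c'" "missing_at D c' u \<beta>"
    "\<And>v. v \<in> {x, y, z} - {u} \<Longrightarrow> missing_at D c' v \<alpha>"
proof -
  let ?a = "partner D c \<alpha>" and ?b = "partner D c \<beta>"
  have fin: "finite (range (\<lambda>n. ((?b \<circ> ?a) ^^ n) u))" for u
  proof -
    have partner_in: "partner D c \<gamma> v \<in> insert u (\<Union>D)" if "v \<in> insert u (\<Union>D)" for \<gamma> v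
      using that by (rule_tac partner_cases[OF c, of \<gamma> v]) auto
    have "((?b \<circ> ?a) ^^ n) u \<in> insert u (\<Union>D)" for n
    proof (induction n)
      case (Suc n)
      show ?case using partner_in[OF partner_in[OF Suc.IH]] by simp
    qed simp
    moreover have "finite e" if "e \<in> D" for e
      using D(2) that by (intro card_ge_0_finite) simp
    then have "finite (insert u (\<Union>D))" using D(1) by blast
    ultimately show ?thesis by (meson finite_subset image_subsetI)
  qed
  obtain S u where Su: "S \<inter> {x, y, z} = {u}"
    and S: "\<And>v. v \<in> S \<Longrightarrow> ?a v \<in> S" "\<And>v. v \<in> S \<Longrightarrow> ?b v \<in> S"
    by (rule isolated_fixed_point[OF partner_involution[OF c, of \<alpha>] partner_involution[OF c, of \<beta>]
          fin missing[THEN partner_missing] dist]) (use that in blast)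
  then have u: "u \<in> {x, y, z}" by blast
  obtain c' where c': "proper_on D n c'"
    "\<And>v. v \<in> S \<Longrightarrow> missing_at D c v \<alpha> \<Longrightarrow> missing_at D c' v \<beta>"
    "\<And>v. v \<notin> S \<Longrightarrow> missing_at D c v \<alpha> \<Longrightarrow> missing_at D c' v \<alpha>"
    using kempe_change[OF c D(2) colors S] by blast
  have \<alpha>_missing: "missing_at D c v \<alpha>" if "v \<in> {x, y, z}" for v
    using that missing by blast
  show thesis
  proof (rule that[OF u c'(1)])
    have "u \<in> S" using Su by blast
    then show "missing_at D c' u \<beta>" using \<alpha>_missing[OF u] by (rule c'(2))
  next
    fix v assume v: "v \<in> {x, y, z} - {u}"
    then have "v \<notin> S" using Su by blast
    moreover have "missing_at D c v \<alpha>" using v \<alpha>_missing by blast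
    ultimately show "missing_at D c' v \<alpha>" by (rule c'(3))
  qed
qed

section \<open>Disjoint uncolored edges\<close>

text \<open>
  The edge \<open>xy\<close> can be moved directly unless \<open>yz\<close> has the color missing at \<open>x\<close>. In that case a Kempe
  change on the graph without the triangle \<open>xyz\<close> first separates the color of one edge of
  the triangle from a color missing at the opposite vertex.
\<close>

lemma disjoint_uncolored_edges:
  assumes E: "finite E" "\<forall>e\<in>E. card e = 2"
    and total: "proper_on E (Suc n) c0"
    and critical: "\<And>e. e \<in> E \<Longrightarrow> \<not> (\<exists>c'. proper_on (E - {e}) n c')"
    and c: "proper_on (E - {{x, y}, {x, z}}) n c"
    and xyz: "{x, y} \<in> E" "{x, z} \<in> E" "x \<noteq> y" "x \<noteq> z" "y \<noteq> z"
  obtains e f c' where "e \<in> E" "f \<in> E" "e \<inter> f = {}" "proper_on (E - {e, f}) n c'"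
proof -
  note found = that
  have move: thesis
    if d: "proper_on (E - {{u, v}, {u, w}}) n d" "\<gamma> < n"
        "missing_at (E - {{u, v}, {u, w}}) d u \<gamma>" "{v, w} \<in> E \<longrightarrow> d {v, w} \<noteq> \<gamma>"
      and uvw: "{u, v} \<in> E" "{u, w} \<in> E" "u \<noteq> v" "u \<noteq> w" "v \<noteq> w" for u v w d \<gamma>
  proof -
    obtain s d' where s: "{v, s} \<in> E" "s \<noteq> u" "s \<noteq> v" "s \<noteq> w"
      and d': "proper_on (E - {{v, s}, {u, w}}) n d'"
      by (rule move_uncolored_edge[OF E(2) uvw(3,4,5,1) d(1) critical[OF uvw(2)] d(2,3,4)]) blast
    have "{v, s} \<inter> {u, w} = {}" using s uvw(3-5) by simp
    then show thesis by (rule found[OF s(1) uvw(2) _ d'])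
  qed
  have "{x, y} \<noteq> {x, z}" using xyz(5) by (simp add: doubleton_eq_iff)
  then obtain \<alpha> where \<alpha>: "\<alpha> < n" "missing_at (E - {{x, y}, {x, z}}) c x \<alpha>"
    using missing_color_exists[OF E(1) total c xyz(1,2), of x] by blast
  show thesis
  proof (cases "{y, z} \<in> E \<and> c {y, z} = \<alpha>")
    case False
    then show thesis using move[OF c \<alpha> _ xyz] by blast
  next
    case True
    let ?T = "E - {{x, y}, {x, z}, {y, z}}"
    \<comment> \<open>The three edges of the triangle have distinct colors in \<open>c0\<close>, so \<open>n\<close> is large enough for a
      second color besides \<open>\<alpha>\<close>.\<close>
    have three: "card {c0 {x, y}, c0 {x, z}, c0 {y, z}} = 3"
      using total xyz True by (auto simp: proper_on_def card_insert_if doubleton_eq_iff)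
    have "card {c0 {x, y}, c0 {x, z}, c0 {y, z}} \<le> card {..<Suc n}"
      using total xyz True by (intro card_mono) (auto simp: proper_on_def)
    then have "2 \<le> n" using three by simp
    define \<beta> :: nat where "\<beta> = (if \<alpha> = 0 then 1 else 0)"
    have \<beta>: "\<beta> < n" "\<beta> \<noteq> \<alpha>" using \<open>2 \<le> n\<close> by (auto simp: \<beta>_def)
    have T: "proper_on ?T n c" using c by (rule proper_on_subset) auto
    have yz: "{y, z} \<in> E - {{x, y}, {x, z}}" using True xyz by (auto simp: doubleton_eq_iff)
    have missing: "missing_at ?T c x \<alpha>" "missing_at ?T c y \<alpha>" "missing_at ?T c z \<alpha>"
    proof -
      show "missing_at ?T c x \<alpha>" using \<alpha>(2) by (rule missing_at_subset) auto
      have "c e \<noteq> \<alpha>" if "e \<in> ?T" "v \<in> e" "v \<in> {y, z}" for e v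
        using proper_on_eqI[OF c _ yz that(2,3)] that(1) True by auto
      then show "missing_at ?T c y \<alpha>" "missing_at ?T c z \<alpha>" by (simp_all add: missing_at_def)
    qed
    have T_edges: "finite ?T" "\<forall>e\<in>?T. card e = 2" using E by auto
    obtain u d where u: "u \<in> {x, y, z}" and d: "proper_on ?T n d" "missing_at ?T d u \<beta>"
      "\<And>v. v \<in> {x, y, z} - {u} \<Longrightarrow> missing_at ?T d v \<alpha>"
      using kempe_change_at_one_of_three[OF T T_edges \<alpha>(1) \<beta>(1) missing xyz(3-5)] by metis
    \<comment> \<open>From here on the triangle is read with \<open>u\<close> as its apex.\<close>
    have "\<exists>v w. (u, v, w) \<in> {(x, y, z), (y, x, z), (z, x, y)}" using u by blast
    then obtain v w where "(u, v, w) \<in> {(x, y, z), (y, x, z), (z, x, y)}" by blast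
    then have vw: "u \<noteq> v" "u \<noteq> w" "v \<noteq> w" "v \<in> {x, y, z} - {u}" "w \<in> {x, y, z} - {u}"
      and uvw: "{u, v} \<in> E" "{u, w} \<in> E" "{v, w} \<in> E"
      and T_eq: "?T = E - {{u, v}, {u, w}, {v, w}}"
      using xyz True by (auto simp: insert_commute)
    have ins: "insert {v, w} ?T = E - {{u, v}, {u, w}}"
      unfolding T_eq using vw(1-3) uvw by (auto simp: doubleton_eq_iff)
    have "proper_on (insert {v, w} ?T) n (d({v, w} := \<alpha>))"
      by (intro proper_on_insert[OF d(1) \<alpha>(1)] d(3) vw(4,5))
    moreover have "missing_at (insert {v, w} ?T) (d({v, w} := \<alpha>)) u \<beta>"
      using d(2) vw(1-3) by (auto simp: missing_at_def)
    ultimately show thesis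
      unfolding ins using move[OF _ \<beta>(1) _ _ uvw(1,2) vw(1-3)] \<beta>(2) by simp
  qed
qed

theorem theorem4p4:
  fixes G :: "'a graph"
  assumes "finite_simple_graph G"
    and "edges G \<noteq> {}"
    and "chromatic_edge_stability_index G = 2"
  shows "\<exists>F. mitigating_set G F \<and> k_matching 2 G F"
proof -
  let ?E = "edges G"
  let ?P = "\<lambda>n. \<exists>F. mitigating_set G F \<and> card F = n"
  have E: "finite ?E" "\<forall>e\<in>?E. card e = 2"
    using assms(1) finite_edges by (auto simp: finite_simple_graph_def)
  have "?P (LEAST n. ?P n)"
    by (rule LeastI_ex) (use mitigating_set_all_edges[OF assms(1,2)] in blast)
  then obtain F where F: "mitigating_set G F" "card F = 2"
    using assms(3) unfolding chromatic_edge_stability_index_def by auto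
  have small: "\<not> mitigating_set G F'" if "card F' < 2" for F'
    using not_less_Least[of "card F'" ?P] that assms(3)
    unfolding chromatic_edge_stability_index_def by auto
  obtain n where n: "chromatic_index G = Suc n"
    using F(1) by (cases "chromatic_index G") (auto simp: mitigating_set_def)
  note mit = mitigating_set_iff[OF assms(1) n]
  obtain c0 where total: "proper_on ?E (Suc n) c0"
    using LeastI_ex[OF proper_edge_coloring_exists[OF assms(1)]] n
    unfolding chromatic_index_def proper_edge_coloring_iff by auto
  have critical: "\<not> (\<exists>c'. proper_on (?E - {e}) n c')" if "e \<in> ?E" for e
    using small[of "{e}"] mit[of "{e}"] that by simp
  obtain e f where ef: "F = {e, f}" "e \<noteq> f" using F(2) by (auto simp: card_2_iff)
  obtain c where c: "e \<in> ?E" "f \<in> ?E" "proper_on (?E - {e, f}) n c"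
    using F(1) unfolding mit ef(1) by auto
  have "\<exists>e f c'. e \<in> ?E \<and> f \<in> ?E \<and> e \<inter> f = {} \<and> proper_on (?E - {e, f}) n c'"
  proof (cases "e \<inter> f = {}")
    case True
    with c show ?thesis by blast
  next
    case False
    then obtain x where x: "x \<in> e" "x \<in> f" by blast
    have "card e = 2" "card f = 2" using E(2) c by auto
    then obtain y z where yz: "e = {x, y}" "f = {x, z}" "x \<noteq> y" "x \<noteq> z"
      using x unfolding card_2_iff by fastforce
    then have "y \<noteq> z" using ef(2) by blast
    show ?thesis
      using disjoint_uncolored_edges[OF E total critical c(3,1,2)[unfolded yz(1,2)] yz(3,4) \<open>y \<noteq> z\<close>]
      by metis
  qed
  then obtain e' f' c' where
    M: "e' \<in> ?E" "f' \<in> ?E" "e' \<inter> f' = {}" "proper_on (?E - {e', f'}) n c'" by blast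
  have "e' \<noteq> f'" using M E(2) by fastforce
  then have "k_matching 2 G {e', f'}"
    using M by (auto simp: k_matching_def matching_def adjacent_edges_def)
  moreover have "mitigating_set G {e', f'}" unfolding mit using M by blast
  ultimately show ?thesis by blast
qed

end
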